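(* For every prime $p\geq 5$, $$\sum_{k=0}^{p-1}(2k+1)^3A_k\equiv p^3+4p^4H_{p-1}+\frac{6}{5}p^8B_{p-5}\pmod{p^9},$$ where $A_k=\sum_{j=0}^{k}\binom{k+j}{j}^2\binom{k}{j}^2$ is the $k$-th Apéry number, $H_{p-1}=\sum_{j=1}^{p-1}\frac1j$, and $B_{p-5}$ is a Bernoulli number.
   Context: The Bernoulli numbers are defined by $B_0=1$ and $\sum_{k=0}^{n-1}\binom{n}{k}B_k=0$ for $n\geq 2$. Congruences between rational numbers modulo a power of $p$ are understood in the ring of rationals whose denominators are prime to $p$. *)

theory Defs
  imports Complex_Main "HOL-Computational_Algebra.Primes"
begin

definition apery :: "nat \<Rightarrow> nat" where
  "apery k = (\<Sum>j=0..k. ((k + j) choose j)^2 * (k choose j)^2)"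

text \<open>The library's \<open>harm\<close> lives in real normed fields, hence not in \<^typ>\<open>rat\<close>.\<close>

definition harmonic :: "nat \<Rightarrow> rat" where
  "harmonic n = (\<Sum>j=1..n. 1 / of_nat j)"

text \<open>
  The recurrence \<open>\<Sum>k<n. (n choose k) * B k = 0\<close> (\<open>n \<ge> 2\<close>) solved for its last term
  \<open>B (n - 1)\<close>; see \<open>bernoulli_recurrence\<close> and \<open>bernoulli_unique\<close> below. The convention is
  \<open>B 1 = -1/2\<close>.
\<close>

fun bernoulli :: "nat \<Rightarrow> rat" where
  "bernoulli n =
     (if n = 0 then 1
      else - (\<Sum>k\<in>{..<n}. of_nat (Suc n choose k) * bernoulli k) / of_nat (Suc n))"

declare bernoulli.simps [simp del]

lemma bernoulli_0: "bernoulli 0 = 1"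
  by (simp add: bernoulli.simps)

lemma bernoulli_recurrence:
  assumes "n \<ge> 2"
  shows "(\<Sum>k=0..n-1. of_nat (n choose k) * bernoulli k) = 0"
proof -
  obtain m where n: "n = Suc m" and m: "m > 0"
    using assms by (cases n) auto
  have "bernoulli m =
      - (\<Sum>k\<in>{..<m}. of_nat (Suc m choose k) * bernoulli k) / of_nat (Suc m)"
    using m by (subst bernoulli.simps) simp
  then have "of_nat (Suc m) * bernoulli m =
      - (\<Sum>k\<in>{..<m}. of_nat (Suc m choose k) * bernoulli k)"
    by (simp del: of_nat_Suc)
  moreover have "{0..n-1} = insert m {..<m}"
    using n by auto
  ultimately show ?thesis
    by (simp add: n del: of_nat_Suc)
qed

lemma bernoulli_unique:
  fixes B :: "nat \<Rightarrow> rat"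
  assumes "B 0 = 1"
    and rec: "\<And>n. n \<ge> 2 \<Longrightarrow> (\<Sum>k=0..n-1. of_nat (n choose k) * B k) = 0"
  shows "B = bernoulli"
proof
  fix n
  show "B n = bernoulli n"
  proof (induction n rule: less_induct)
    case (less n)
    show ?case
    proof (cases "n = 0")
      case True
      then show ?thesis by (simp add: assms(1) bernoulli_0)
    next
      case False
      have eq: "{0..Suc n - 1} = insert n {..<n}" by auto
      have "(\<Sum>k\<in>{..<n}. of_nat (Suc n choose k) * B k) =
          (\<Sum>k\<in>{..<n}. of_nat (Suc n choose k) * bernoulli k)"
        using less.IH by (intro sum.cong) auto
      moreover have "of_nat (Suc n) * B n + (\<Sum>k\<in>{..<n}. of_nat (Suc n choose k) * B k) = 0"
        using rec[of "Suc n"] False unfolding eq by (simp del: of_nat_Suc)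
      moreover have "of_nat (Suc n) * bernoulli n +
          (\<Sum>k\<in>{..<n}. of_nat (Suc n choose k) * bernoulli k) = 0"
        using bernoulli_recurrence[of "Suc n"] False unfolding eq by (simp del: of_nat_Suc)
      ultimately have "of_nat (Suc n) * B n = of_nat (Suc n) * bernoulli n"
        by (metis add_right_cancel)
      then show ?thesis by (simp del: of_nat_Suc)
    qed
  qed
qed

definition p_integral :: "nat \<Rightarrow> rat set" where
  "p_integral p = {x. coprime (snd (quotient_of x)) (int p)}"

definition cong_pow :: "nat \<Rightarrow> nat \<Rightarrow> rat \<Rightarrow> rat \<Rightarrow> bool" where
  "cong_pow p e x y \<longleftrightarrow>
     x \<in> p_integral p \<and> y \<in> p_integral p \<and>
     (\<exists>z\<in>p_integral p. x - y = of_nat p ^ e * z)"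

end

theory Submission
  imports Defs "HOL-Number_Theory.Residues"
begin

text \<open>
  For each \<open>j\<close>, the sum over \<open>k < n\<close> of \<open>(2k + 1)\<^sup>3 ((k + j) choose j)\<^sup>2 (k choose j)\<^sup>2\<close> telescopes, and
  summation by parts over \<open>j\<close> then gives, for \<open>n = p\<close>, the exact value
  \<open>p\<^sup>2 (p a(p-1) + p\<^sup>4 \<Sum>j=1..p-1. a(j-1) / j\<^sup>3)\<close> with \<open>a(j) = (\<Prod>i=1..j. 1 - p\<^sup>2/i\<^sup>2)\<^sup>2\<close>.
  Expand \<open>a\<close> in powers of \<open>p\<close> and write \<open>H(s) = \<Sum>j=1..p-1. 1/j\<^sup>s\<close>. The reflection \<open>j \<mapsto> p - j\<close> expresses
  \<open>H(1)\<close> modulo \<open>p\<^sup>5\<close> and \<open>H(3)\<close> modulo \<open>p\<^sup>3\<close> through \<open>H(2)\<close>, \<open>H(4)\<close> and \<open>H(5)\<close>, so for \<open>p \<ge> 7\<close> only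
  two facts remain: \<open>H(4) \<equiv> 4/5 p B(p-5)\<close> modulo \<open>p\<^sup>2\<close>, and
  \<open>\<Sum>i<j. 1/(i\<^sup>2 j\<^sup>3) \<equiv> -2 B(p-5)\<close> modulo \<open>p\<close>. The prime \<open>5\<close>, for which \<open>H(4)\<close> is not divisible by \<open>p\<close>,
  is checked by computation.
\<close>

section \<open>An exact formula for the sum\<close>

text \<open>Induction on \<open>n\<close>. Up to sign, \<open>b n\<close> and
  \<open>b (Suc n)\<close> are \<open>n - j\<close> and \<open>n + 1 + j\<close> times the same
  number \<open>c j\<close>, whose square is the new summand without its cubic factor. The induction
  step thus reduces to a polynomial identity.\<close>

lemma sum_cube_binomial_products:
  fixes n j :: nat
  defines "b \<equiv> \<lambda>n. of_nat n * (\<Prod>i=1..j. 1 - (of_nat n)\<^sup>2 / (of_nat i)\<^sup>2) :: rat"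
  shows "(\<Sum>k<n. (2 * of_nat k + 1)^3 * of_nat (((k + j) choose j)^2 * (k choose j)^2))
    = (2 * (of_nat n)\<^sup>2 / (of_nat j + 1) - 1) * (b n)\<^sup>2"
proof (induction n)
  case 0
  then show ?case by (simp add: b_def)
next
  case (Suc n)
  define c :: "nat \<Rightarrow> rat" where "c l = of_nat (((n + l) choose l) * (n choose l))" for l
  have c_Suc: "c (Suc l) = (of_nat n + of_nat l + 1) * (of_nat n - of_nat l) / (of_nat l + 1)\<^sup>2 * c l" for l
  proof -
    \<comment> \<open>The factor \<open>n - l\<close> is a rational difference; for
      \<open>l > n\<close> both binomial coefficients vanish, so no truncated subtraction
      enters.\<close>
    have 1: "of_nat (n choose Suc l) * (of_nat l + 1) = (of_nat (n choose l) * (of_nat n - of_nat l) :: rat)"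
    proof (cases "l \<le> n")
      case True
      have "(n choose Suc l) * Suc l = (n choose l) * (n - l)"
        using binomial_absorb_comp[of n l] binomial_absorption[of l n]
        by (metis binomial_absorption binomial_absorb_comp mult.commute)
      then have "of_nat ((n choose Suc l) * Suc l) = (of_nat ((n choose l) * (n - l)) :: rat)" by simp
      then show ?thesis using True by (simp add: of_nat_diff algebra_simps)
    qed (simp add: binomial_eq_0)
    have "Suc l * ((n + Suc l) choose Suc l) = (n + Suc l) * ((n + l) choose l)"
      using binomial_absorption[of l "n + Suc l"] by simp
    then have "of_nat (Suc l) * of_nat ((n + Suc l) choose Suc l)
        = (of_nat (n + Suc l) * of_nat ((n + l) choose l) :: rat)"
      by (metis of_nat_mult)
    then have 2: "of_nat ((n + Suc l) choose Suc l) * (of_nat l + 1)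
        = (of_nat n + of_nat l + 1) * (of_nat ((n + l) choose l) :: rat)"
      by (simp add: algebra_simps del: binomial_Suc_Suc)
    have "c (Suc l) * (of_nat l + 1)\<^sup>2 = (of_nat n + of_nat l + 1) * (of_nat n - of_nat l) * c l"
      using arg_cong2[OF 1 2, of "(*)"] by (simp add: c_def power2_eq_square mult_ac del: binomial_Suc_Suc)
    moreover have "(of_nat l + 1 :: rat) \<noteq> 0" by (metis of_nat_Suc of_nat_neq_0 add.commute)
    ultimately show ?thesis by (simp add: field_simps)
  qed
  have nz: "(1 + of_nat l :: rat) \<noteq> 0" for l by (metis of_nat_Suc of_nat_neq_0)
  have low: "of_nat n * (\<Prod>i=1..l. 1 - (of_nat n)\<^sup>2 / (of_nat i)\<^sup>2)
      = (- 1) ^ l * (of_nat n - of_nat l) * c l" for l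
  proof (induction l)
    case 0 then show ?case by (simp add: c_def)
  next
    case (Suc l)
    have "of_nat n * (\<Prod>i=1..Suc l. 1 - (of_nat n)\<^sup>2 / (of_nat i)\<^sup>2)
      = (- 1) ^ l * (of_nat n - of_nat l) * c l * (1 - (of_nat n)\<^sup>2 / (of_nat (Suc l))\<^sup>2)"
      using Suc.IH by simp
    also have "\<dots> = (- 1) ^ Suc l * (of_nat n - of_nat (Suc l)) * c (Suc l)"
    proof -
      have "s * (x - y) * z * (1 - x\<^sup>2 / (1 + y)\<^sup>2)
          = - s * (x - (1 + y)) * ((x + y + 1) * (x - y) / (1 + y)\<^sup>2 * z)"
        if "1 + y \<noteq> 0" for s x y z :: rat
        using that by (simp add: divide_simps) (simp add: algebra_simps power2_eq_square)
      from this[OF nz[of l], of "(- 1) ^ l" "of_nat n" "c l"] show ?thesis by (simp add: c_Suc add_ac)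
    qed
    finally show ?case .
  qed
  have up: "of_nat (Suc n) * (\<Prod>i=1..l. 1 - (of_nat (Suc n))\<^sup>2 / (of_nat i)\<^sup>2)
      = (- 1) ^ l * (of_nat n + 1 + of_nat l) * c l" for l
  proof (induction l)
    case 0 then show ?case by (simp add: c_def)
  next
    case (Suc l)
    have "of_nat (Suc n) * (\<Prod>i=1..Suc l. 1 - (of_nat (Suc n))\<^sup>2 / (of_nat i)\<^sup>2)
      = (- 1) ^ l * (of_nat n + 1 + of_nat l) * c l * (1 - (of_nat (Suc n))\<^sup>2 / (of_nat (Suc l))\<^sup>2)"
      using Suc.IH by simp
    also have "\<dots> = (- 1) ^ Suc l * (of_nat n + 1 + of_nat (Suc l)) * c (Suc l)"
    proof -
      have "s * (x + 1 + y) * z * (1 - (1 + x)\<^sup>2 / (1 + y)\<^sup>2)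
          = - s * (x + 1 + (1 + y)) * ((x + y + 1) * (x - y) / (1 + y)\<^sup>2 * z)"
        if "1 + y \<noteq> 0" for s x y z :: rat
        using that by (simp add: divide_simps) (simp add: algebra_simps power2_eq_square)
      from this[OF nz[of l], of "(- 1) ^ l" "of_nat n" "c l"] show ?thesis by (simp add: c_Suc add_ac)
    qed
    finally show ?case .
  qed
  have sq: "((- 1 :: rat) ^ j)\<^sup>2 = 1" by (simp add: power_even_eq[symmetric])
  have b1: "(b n)\<^sup>2 = (of_nat n - of_nat j)\<^sup>2 * (c j)\<^sup>2"
    unfolding b_def low by (simp add: power_mult_distrib sq)
  have b2: "(b (Suc n))\<^sup>2 = (of_nat n + 1 + of_nat j)\<^sup>2 * (c j)\<^sup>2"
    unfolding b_def up by (simp add: power_mult_distrib sq)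
  have "of_nat (((n + j) choose j)^2 * (n choose j)^2) = (c j)\<^sup>2"
    by (simp add: c_def power_mult_distrib)
  then have "(\<Sum>k<Suc n. (2 * of_nat k + 1)^3 * of_nat (((k + j) choose j)^2 * (k choose j)^2))
     = (2 * (of_nat n)\<^sup>2 / (of_nat j + 1) - 1) * (b n)\<^sup>2 + (2 * of_nat n + 1)^3 * (c j)\<^sup>2"
    using Suc.IH by simp
  \<comment> \<open>Without the common factor \<open>(c j)^2\<close> this says
    \<open>(2*(n+1)^2/(j+1) - 1)*(n+1+j)^2 - (2*n^2/(j+1) - 1)*(n-j)^2 = (2*n+1)^3\<close>.\<close>
  also have "\<dots> = (2 * (of_nat (Suc n))\<^sup>2 / (of_nat j + 1) - 1) * (b (Suc n))\<^sup>2"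
    unfolding b1 b2 using nz[of j] by (simp add: divide_simps) (simp add: algebra_simps eval_nat_numeral)
  finally show ?case .
qed

lemma sum_cube_apery:
  "(\<Sum>k<n. of_nat ((2 * k + 1)^3 * apery k) :: rat)
    = (of_nat n)\<^sup>2 * (\<Sum>j<n. (2 * (of_nat n)\<^sup>2 / (of_nat j + 1) - 1)
        * (\<Prod>i=1..j. 1 - (of_nat n)\<^sup>2 / (of_nat i)\<^sup>2)\<^sup>2)"
proof -
  \<comment> \<open>Since \<open>k choose j\<close> vanishes for \<open>j > k\<close>, all inner
    sums can share the range \<open>j < n\<close>, and the two summations can be exchanged.\<close>
  have ap: "apery k = (\<Sum>j<n. ((k + j) choose j)^2 * (k choose j)^2)" if "k < n" for k
    unfolding apery_def using that by (intro sum.mono_neutral_left) (auto simp: binomial_eq_0)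
  have "(\<Sum>k<n. of_nat ((2 * k + 1)^3 * apery k) :: rat)
     = (\<Sum>k<n. \<Sum>j<n. (2 * of_nat k + 1)^3 * of_nat (((k + j) choose j)^2 * (k choose j)^2))"
    by (intro sum.cong refl) (simp add: ap sum_distrib_left add.commute)
  also have "\<dots> = (\<Sum>j<n. \<Sum>k<n. (2 * of_nat k + 1)^3 * of_nat (((k + j) choose j)^2 * (k choose j)^2))"
    by (rule sum.swap)
  also have "\<dots> = (\<Sum>j<n. (2 * (of_nat n)\<^sup>2 / (of_nat j + 1) - 1)
        * (of_nat n * (\<Prod>i=1..j. 1 - (of_nat n)\<^sup>2 / (of_nat i)\<^sup>2))\<^sup>2)"
    by (simp only: sum_cube_binomial_products)
  finally show ?thesis
    by (simp add: sum_distrib_left power_mult_distrib mult_ac)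
qed

text \<open>Applied with \<open>m + 1 = x\<close>, where the coefficient of \<open>a m\<close> collapses to \<open>x\<close>.\<close>

lemma sum_by_parts_products:
  fixes x :: rat
  defines "a \<equiv> \<lambda>j::nat. (\<Prod>i=1..j. 1 - x\<^sup>2 / (of_nat i)\<^sup>2)\<^sup>2"
  shows "(\<Sum>j<Suc m. (2 * x\<^sup>2 / (of_nat j + 1) - 1) * a j)
    = (2 * x\<^sup>2 / (of_nat m + 1) - (of_nat m + 1)) * a m
      + x^4 * (\<Sum>j=1..m. a (j - 1) / (of_nat j)^3)"
proof (induction m)
  case 0
  then show ?case by simp
next
  case (Suc m)
  have nz: "(1 + of_nat m :: rat) \<noteq> 0" "(2 + of_nat m :: rat) \<noteq> 0"
    by (metis of_nat_Suc of_nat_neq_0, metis of_nat_Suc of_nat_neq_0 add_2_eq_Suc of_nat_add of_nat_numeral)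
  have a_Suc: "a (Suc m) = a m * (1 - x\<^sup>2 / (of_nat m + 1)\<^sup>2)\<^sup>2"
    by (simp add: a_def power_mult_distrib add.commute)
  have "(\<Sum>j<Suc (Suc m). (2 * x\<^sup>2 / (of_nat j + 1) - 1) * a j)
    = (2 * x\<^sup>2 / (of_nat m + 1) - (of_nat m + 1)) * a m
      + x^4 * (\<Sum>j=1..m. a (j - 1) / (of_nat j)^3)
      + (2 * x\<^sup>2 / (of_nat m + 2) - 1) * a (Suc m)"
    using Suc.IH by (subst sum.lessThan_Suc) (simp add: add_ac)
  \<comment> \<open>Because \<open>u * (1 - x^2/u^2)^2 = u - 2*x^2/u + x^4/u^3\<close>, the boundary
    term at \<open>m\<close> turns into one at \<open>Suc m\<close> plus the next summand of the new
    sum.\<close>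
  also have "(2 * x\<^sup>2 / (of_nat m + 1) - (of_nat m + 1)) * a m
     = x^4 * (a m / (of_nat m + 1)^3) - (of_nat m + 1) * a (Suc m)"
  proof -
    have "(2 * x\<^sup>2 / u - u) * y = x^4 * (y / u^3) - u * (y * (1 - x\<^sup>2 / u\<^sup>2)\<^sup>2)" if "u \<noteq> 0" for u y :: rat
      using that by (simp add: field_simps eval_nat_numeral)
    then show ?thesis unfolding a_Suc using nz by (simp add: add.commute)
  qed
  finally show ?case
    by (simp add: algebra_simps)
qed

section \<open>Faulhaber's formula\<close>

text \<open>Raising \<open>n\<close> by one must add \<open>(m + 1) * n^m\<close>. Expand
  \<open>(n + 1)^M - n^M\<close> binomially and exchange the sums: the coefficient of
  \<open>n^l\<close> contains the Bernoulli recurrence of order \<open>m + 1 - l\<close>, which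
  vanishes unless \<open>l = m\<close>.\<close>

lemma bernoulli_faulhaber:
  "of_nat (Suc m) * (\<Sum>j<n. (of_nat j :: rat) ^ m)
    = (\<Sum>k\<le>m. of_nat (Suc m choose k) * bernoulli k * of_nat n ^ (Suc m - k))"
proof (induction n)
  case 0
  then show ?case by (simp add: zero_power)
next
  case (Suc n)
  let ?x = "of_nat n :: rat"
  have inner: "(\<Sum>k\<le>m-l. of_nat (Suc m - l choose k) * bernoulli k) = (if l = m then 1 else 0)"
    if "l \<le> m" for l
  proof (cases "l = m")
    case False
    then have "Suc m - l \<ge> 2" and "Suc m - l - 1 = m - l" using that by auto
    then show ?thesis using bernoulli_recurrence[of "Suc m - l"] False by (simp add: atMost_atLeast0)
  qed (simp add: bernoulli_0)
  have diff: "(?x + 1) ^ M - ?x ^ M = (\<Sum>l<M. of_nat (M choose l) * ?x ^ l)" for M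
    by (simp add: binomial_ring lessThan_Suc_atMost[symmetric])
  have "(\<Sum>k\<le>m. of_nat (Suc m choose k) * bernoulli k * of_nat (Suc n) ^ (Suc m - k))
      - (\<Sum>k\<le>m. of_nat (Suc m choose k) * bernoulli k * ?x ^ (Suc m - k))
    = (\<Sum>k\<le>m. of_nat (Suc m choose k) * bernoulli k * ((?x + 1) ^ (Suc m - k) - ?x ^ (Suc m - k)))"
    by (simp add: sum_subtractf[symmetric] algebra_simps)
  also have "\<dots> = (\<Sum>k\<le>m. \<Sum>l\<le>m-k. of_nat (Suc m choose l) * ?x ^ l * (of_nat (Suc m - l choose k) * bernoulli k))"
  proof (intro sum.cong refl)
    fix k assume "k \<in> {..m}"
    then have k: "k \<le> m" by simp
    have "of_nat (Suc m choose k) * bernoulli k * (of_nat (Suc m - k choose l) * ?x ^ l)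
      = of_nat (Suc m choose l) * ?x ^ l * (of_nat (Suc m - l choose k) * bernoulli k)" if "l \<le> m - k" for l
    proof -
      have "(Suc m choose k) * (Suc m - k choose l) = (Suc m choose (k + l)) * (k + l choose k)"
        using choose_mult[of k "k + l" "Suc m"] that k by simp
      also have "\<dots> = (Suc m choose (k + l)) * (k + l choose l)"
        using binomial_symmetric[of k "k + l"] by simp
      also have "\<dots> = (Suc m choose l) * (Suc m - l choose k)"
        using choose_mult[of l "k + l" "Suc m"] that k by simp
      finally have "of_nat (Suc m choose k) * of_nat (Suc m - k choose l)
          = (of_nat (Suc m choose l) * of_nat (Suc m - l choose k) :: rat)"
        by (metis of_nat_mult)
      moreover have "u * s * (v * t) = u' * t * (v' * s)" if "u * v = u' * v'" for u v u' v' s t :: rat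
        using arg_cong[OF that, of "\<lambda>w. w * (s * t)"] by (simp add: mult_ac)
      ultimately show ?thesis by blast
    qed
    moreover have "{..<Suc m - k} = {..m - k}" using k by auto
    ultimately show "of_nat (Suc m choose k) * bernoulli k * ((?x + 1) ^ (Suc m - k) - ?x ^ (Suc m - k))
      = (\<Sum>l\<le>m-k. of_nat (Suc m choose l) * ?x ^ l * (of_nat (Suc m - l choose k) * bernoulli k))"
      unfolding diff sum_distrib_left by (intro sum.cong) auto
  qed
  \<comment> \<open>The index set is the triangle \<open>k + l \<le> m\<close>, symmetric in
    \<open>k\<close> and \<open>l\<close>; this form makes the exchange of sums applicable.\<close>
  also have "\<dots> = (\<Sum>k\<le>m. \<Sum>l | l \<in> {..m} \<and> l \<le> m - k. of_nat (Suc m choose l) * ?x ^ l * (of_nat (Suc m - l choose k) * bernoulli k))"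
    by (intro sum.cong refl) auto
  also have "\<dots> = (\<Sum>l\<le>m. \<Sum>k | k \<in> {..m} \<and> l \<le> m - k. of_nat (Suc m choose l) * ?x ^ l * (of_nat (Suc m - l choose k) * bernoulli k))"
    by (rule sum.swap_restrict) auto
  also have "\<dots> = (\<Sum>l\<le>m. \<Sum>k\<le>m-l. of_nat (Suc m choose l) * ?x ^ l * (of_nat (Suc m - l choose k) * bernoulli k))"
    by (intro sum.cong refl) auto
  also have "\<dots> = (\<Sum>l\<le>m. of_nat (Suc m choose l) * ?x ^ l * (if l = m then 1 else 0))"
    unfolding sum_distrib_left[symmetric] by (intro sum.cong refl arg_cong2[where f="(*)"] inner) auto
  also have "\<dots> = of_nat (Suc m) * ?x ^ m"
    by (simp add: sum.delta if_distrib cong: if_cong)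
  finally show ?case using Suc.IH by (simp add: algebra_simps)
qed

section \<open>Rationals with denominator prime to \<open>p\<close>\<close>

text \<open>The ideal generated by \<open>p^e\<close> in the localization of the integers at
  \<open>p\<close>. Congruences are handled as membership of a difference in it, so that they
  combine linearly with p-integral coefficients.\<close>

definition p_ideal :: "nat \<Rightarrow> nat \<Rightarrow> rat set" where
  "p_ideal p e = (\<lambda>z. of_nat p ^ e * z) ` p_integral p"

locale prime_localization =
  fixes p :: nat
  assumes prime: "prime p"
begin

abbreviation Z :: "rat set" where "Z \<equiv> p_integral p"
abbreviation I :: "nat \<Rightarrow> rat set" where "I \<equiv> p_ideal p"

text \<open>Admitting unreduced fractions makes closure under sums and products immediate.
  Conversely, the reduced denominator divides any other denominator and so inherits coprimality to
  \<open>p\<close>.\<close>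

lemma Z_iff: "x \<in> Z \<longleftrightarrow> (\<exists>a b. coprime b (int p) \<and> b \<noteq> 0 \<and> x = of_int a / of_int b)"
proof
  assume "x \<in> Z"
  then have "coprime (snd (quotient_of x)) (int p)" by (simp add: p_integral_def)
  moreover have "x = of_int (fst (quotient_of x)) / of_int (snd (quotient_of x))"
    by (simp add: quotient_of_div)
  moreover have "snd (quotient_of x) \<noteq> 0"
    using quotient_of_denom_pos'[of x] by simp
  ultimately show "\<exists>a b. coprime b (int p) \<and> b \<noteq> 0 \<and> x = of_int a / of_int b" by blast
next
  assume "\<exists>a b. coprime b (int p) \<and> b \<noteq> 0 \<and> x = of_int a / of_int b"
  then obtain a b where ab: "coprime b (int p)" "b \<noteq> 0" "x = of_int a / of_int b" by blast
  obtain c d where q: "quotient_of x = (c, d)" by fastforce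
  have "d > 0" "coprime c d" "x = of_int c / of_int d"
    using q quotient_of_denom_pos quotient_of_coprime quotient_of_div by blast+
  then have "of_int (c * b) = (of_int (a * d) :: rat)"
    using ab by (simp add: field_simps)
  then have "c * b = a * d" by (simp only: of_int_eq_iff)
  then have "d dvd c * b" by simp
  then have "d dvd b"
    using \<open>coprime c d\<close> by (simp add: coprime_commute coprime_dvd_mult_right_iff)
  then have "coprime d (int p)" using ab(1) coprime_divisors dvd_refl by blast
  then show "x \<in> Z" by (simp add: p_integral_def q)
qed

lemma Z_of_int [simp]: "of_int a \<in> Z"
  unfolding Z_iff by (rule exI[of _ a], rule exI[of _ 1]) simp

lemma Z_of_nat [simp]: "of_nat a \<in> Z"
  using Z_of_int[of "int a"] by simp

lemma Z_numeral [simp]: "numeral n \<in> Z"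
  using Z_of_int[of "numeral n"] by simp

lemma Z_0 [simp]: "0 \<in> Z" and Z_1 [simp]: "1 \<in> Z"
  using Z_of_int[of 0] Z_of_int[of 1] by simp_all

lemma Z_add [simp, intro]: "x \<in> Z \<Longrightarrow> y \<in> Z \<Longrightarrow> x + y \<in> Z"
proof -
  assume "x \<in> Z" "y \<in> Z"
  then obtain a b c d where "coprime b (int p)" "b \<noteq> 0" "x = of_int a / of_int b"
      "coprime d (int p)" "d \<noteq> 0" "y = of_int c / of_int d"
    unfolding Z_iff by blast
  then have "coprime (b * d) (int p)" "b * d \<noteq> 0" "x + y = of_int (a * d + c * b) / of_int (b * d)"
    by (auto simp: field_simps)
  then show ?thesis unfolding Z_iff by blast
qed

lemma Z_mult [simp, intro]: "x \<in> Z \<Longrightarrow> y \<in> Z \<Longrightarrow> x * y \<in> Z"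
proof -
  assume "x \<in> Z" "y \<in> Z"
  then obtain a b c d where "coprime b (int p)" "b \<noteq> 0" "x = of_int a / of_int b"
      "coprime d (int p)" "d \<noteq> 0" "y = of_int c / of_int d"
    unfolding Z_iff by blast
  then have "coprime (b * d) (int p)" "b * d \<noteq> 0" "x * y = of_int (a * c) / of_int (b * d)"
    by auto
  then show ?thesis unfolding Z_iff by blast
qed

lemma Z_minus [simp, intro]: "x \<in> Z \<Longrightarrow> - x \<in> Z"
  using Z_mult[OF Z_of_int[of "-1"]] by fastforce

lemma Z_diff [simp, intro]: "x \<in> Z \<Longrightarrow> y \<in> Z \<Longrightarrow> x - y \<in> Z"
  using Z_add[of x "- y"] by auto

lemma Z_power [simp, intro]: "x \<in> Z \<Longrightarrow> x ^ n \<in> Z"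
  by (induction n) auto

lemma Z_sum [simp, intro]: "(\<And>i. i \<in> A \<Longrightarrow> f i \<in> Z) \<Longrightarrow> sum f A \<in> Z"
  by (induction A rule: infinite_finite_induct) auto

lemma Z_inverse_of_nat: "\<not> p dvd n \<Longrightarrow> 1 / of_nat n \<in> Z"
proof -
  assume "\<not> p dvd n"
  then have "coprime n p" "n \<noteq> 0"
    using prime prime_imp_coprime[of p n] by (auto simp: coprime_commute intro: Nat.gr0I)
  then show ?thesis unfolding Z_iff
    by (intro exI[of _ 1] exI[of _ "int n"]) auto
qed

lemma Z_divide_of_nat: "x \<in> Z \<Longrightarrow> \<not> p dvd n \<Longrightarrow> x / of_nat n \<in> Z"
  using Z_mult[OF _ Z_inverse_of_nat] by fastforce

lemma I_iff: "x \<in> I e \<longleftrightarrow> (\<exists>z\<in>Z. x = of_nat p ^ e * z)"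
  by (auto simp: p_ideal_def)

lemma I_0 [simp]: "0 \<in> I e"
  unfolding I_iff by (rule bexI[of _ 0]) auto

lemma I_add [intro]: "x \<in> I e \<Longrightarrow> y \<in> I e \<Longrightarrow> x + y \<in> I e"
  unfolding I_iff by (auto simp: distrib_left[symmetric])

lemma I_mult: "x \<in> I e \<Longrightarrow> y \<in> I f \<Longrightarrow> x * y \<in> I (e + f)"
proof -
  assume "x \<in> I e" "y \<in> I f"
  then obtain s t where "s \<in> Z" "t \<in> Z" "x = of_nat p ^ e * s" "y = of_nat p ^ f * t"
    unfolding I_iff by auto
  then show ?thesis unfolding I_iff by (intro bexI[of _ "s * t"]) (auto simp: power_add)
qed

lemma I_eq_Z: "I 0 = Z"
  by (auto simp: p_ideal_def)

lemma I_mult_Z [intro]: "x \<in> I e \<Longrightarrow> y \<in> Z \<Longrightarrow> x * y \<in> I e"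
  using I_mult[of x e y 0] by (simp add: I_eq_Z)

lemma I_Z_mult [intro]: "y \<in> Z \<Longrightarrow> x \<in> I e \<Longrightarrow> y * x \<in> I e"
  using I_mult[of y 0 x e] by (simp add: I_eq_Z)

lemma I_minus [intro]: "x \<in> I e \<Longrightarrow> - x \<in> I e"
  using I_Z_mult[OF Z_of_int[of "-1"], of x e] by simp

lemma I_diff [intro]: "x \<in> I e \<Longrightarrow> y \<in> I e \<Longrightarrow> x - y \<in> I e"
  using I_add[of x e "- y"] by auto

lemma I_sum [intro]: "(\<And>i. i \<in> A \<Longrightarrow> f i \<in> I e) \<Longrightarrow> sum f A \<in> I e"
  by (induction A rule: infinite_finite_induct) auto

lemma I_antimono: "x \<in> I e \<Longrightarrow> f \<le> e \<Longrightarrow> x \<in> I f"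
proof -
  assume "x \<in> I e" "f \<le> e"
  then obtain z where z: "z \<in> Z" "x = of_nat p ^ e * z" unfolding I_iff by auto
  have "x = of_nat p ^ f * (of_nat p ^ (e - f) * z)"
    using z(2) \<open>f \<le> e\<close> by (simp add: mult.assoc[symmetric] power_add[symmetric])
  moreover have "of_nat p ^ (e - f) * z \<in> Z" using z(1) by auto
  ultimately show ?thesis unfolding I_iff by blast
qed

lemma I_power_p: "f \<le> e \<Longrightarrow> of_nat p ^ e \<in> I f"
  by (rule I_antimono[of _ e]) (auto simp: I_iff intro: bexI[of _ 1])

lemma I_p_power_mult: "x \<in> I e \<Longrightarrow> g = f + e \<Longrightarrow> of_nat p ^ f * x \<in> I g"
  using I_mult[OF I_power_p[OF order_refl]] by blast

lemma p_multiple_I: "e \<le> f \<Longrightarrow> x \<in> Z \<Longrightarrow> of_nat p ^ f * x \<in> I e"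
  by (intro I_mult_Z I_power_p)

text \<open>Integrality of \<open>x\<close> follows from \<open>x = y + p^e * z\<close>, so only the
  explicit right-hand side has to be shown p-integral.\<close>

lemma cong_pow_I:
  assumes "x - y \<in> I e" "y \<in> Z"
  shows "cong_pow p e x y"
proof -
  obtain z where z: "z \<in> Z" "x - y = of_nat p ^ e * z" using assms(1) unfolding I_iff by auto
  have "x = y + of_nat p ^ e * z" using z(2) by simp
  moreover have "y + of_nat p ^ e * z \<in> Z" using z(1) assms(2) by auto
  ultimately show ?thesis unfolding cong_pow_def using z assms(2) by blast
qed

lemma not_dvd_residue: "j \<in> {1..p-1} \<Longrightarrow> \<not> p dvd j"
  by (auto dest: dvd_imp_le)

lemma Z_inverse_power: "\<not> p dvd j \<Longrightarrow> 1 / of_nat j ^ k \<in> Z"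
  using Z_power[OF Z_inverse_of_nat, of j k] by (simp add: power_one_over)

lemma fermat_I:
  assumes "\<not> p dvd j"
  shows "of_nat j ^ (p - 1) - 1 \<in> I 1"
proof -
  have "[j ^ (p - 1) = 1] (mod p)"
    using fermat_theorem[OF prime assms] .
  then have "int p dvd int (j ^ (p - 1)) - 1"
    by (metis cong_iff_dvd_diff cong_int_iff of_nat_1)
  then obtain c where c: "int (j ^ (p - 1)) - 1 = int p * c" by blast
  have "of_int (int (j ^ (p - 1)) - 1) = (of_int (int p * c) :: rat)" by (simp only: c)
  then have "of_nat j ^ (p - 1) - 1 = of_nat p * (of_int c :: rat)" by simp
  then show ?thesis unfolding I_iff by (auto intro!: bexI[of _ "of_int c"])
qed

text \<open>Fermat's congruence divided by \<open>j^k\<close>. It trades negative exponents for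
  nonnegative ones modulo \<open>p\<close>, which makes Faulhaber's formula available for harmonic
  sums.\<close>

lemma fermat_inverse:
  assumes "\<not> p dvd j" "k \<le> p - 1"
  shows "of_nat j ^ (p - 1 - k) - 1 / of_nat j ^ k \<in> I 1"
proof -
  have "(of_nat j :: rat) ^ (p - 1) = of_nat j ^ (p - 1 - k) * of_nat j ^ k"
    using assms(2) by (metis le_add_diff_inverse2 power_add)
  moreover have "(of_nat j :: rat) \<noteq> 0" using assms(1) by (auto intro: ccontr)
  ultimately have "of_nat j ^ (p - 1 - k) - 1 / of_nat j ^ k
      = (1 / of_nat j ^ k) * (of_nat j ^ (p - 1) - 1 :: rat)"
    by (simp add: field_simps)
  then show ?thesis using I_Z_mult[OF Z_inverse_power fermat_I] assms(1) by metis
qed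

section \<open>Power sums and harmonic sums\<close>

text \<open>The recursion up to index \<open>k\<close> divides only by numbers at most
  \<open>k + 1 < p\<close>.\<close>

lemma bernoulli_Z: "k + 2 \<le> p \<Longrightarrow> bernoulli k \<in> Z"
proof (induction k rule: less_induct)
  case (less k)
  have "(\<Sum>i<k. of_nat (Suc k choose i) * bernoulli i) \<in> Z"
    using less by (intro Z_sum Z_mult) auto
  moreover have "\<not> p dvd Suc k"
    using less.prems by (auto dest: dvd_imp_le)
  ultimately show ?case
    by (subst bernoulli.simps) (auto intro!: Z_divide_of_nat simp del: of_nat_Suc)
qed

text \<open>In Faulhaber's formula at \<open>n = p\<close> the term \<open>k = m\<close> is
  \<open>(m + 1) * p * B m\<close>; every earlier term carries at least \<open>p^2\<close>, and
  \<open>m + 1\<close> is invertible.\<close>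

lemma power_sum_bernoulli:
  assumes "0 < m" "m + 2 \<le> p"
  shows "(\<Sum>j=1..p-1. of_nat j ^ m) - of_nat p * bernoulli m \<in> I 2"
proof -
  define s :: rat where "s = (\<Sum>j=1..p-1. of_nat j ^ m)"
  have "{..<p} = insert 0 {1..p-1}" using assms by auto
  then have "s = (\<Sum>j<p. of_nat j ^ m)" using assms(1) by (simp add: s_def zero_power)
  then have "of_nat (Suc m) * s
      = (\<Sum>k\<le>m. of_nat (Suc m choose k) * bernoulli k * of_nat p ^ (Suc m - k))"
    by (simp only: bernoulli_faulhaber)
  also have "\<dots> = (\<Sum>k<m. of_nat (Suc m choose k) * bernoulli k * of_nat p ^ (Suc m - k))
      + of_nat (Suc m) * (of_nat p * bernoulli m)"
    by (simp add: lessThan_Suc_atMost[symmetric] del: of_nat_Suc)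
  finally have "of_nat (Suc m) * (s - of_nat p * bernoulli m)
      = (\<Sum>k<m. of_nat (Suc m choose k) * bernoulli k * of_nat p ^ (Suc m - k))"
    by (simp add: right_diff_distrib del: of_nat_Suc)
  moreover have "\<dots> \<in> I 2"
    using assms by (intro I_sum I_Z_mult Z_mult I_power_p bernoulli_Z) auto
  ultimately have "of_nat (Suc m) * (s - of_nat p * bernoulli m) \<in> I 2" by argo
  then have "1 / of_nat (Suc m) * (of_nat (Suc m) * (s - of_nat p * bernoulli m)) \<in> I 2"
    using assms by (intro I_Z_mult[OF Z_inverse_of_nat]) (auto dest: dvd_imp_le)
  then show ?thesis by (simp add: s_def del: of_nat_Suc)
qed

lemma power_sum_I:
  assumes "0 < m" "m + 2 \<le> p"
  shows "(\<Sum>j=1..p-1. of_nat j ^ m) \<in> I 1"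
proof -
  have "of_nat p ^ 1 * bernoulli m \<in> I 1" using assms by (intro p_multiple_I bernoulli_Z) auto
  from I_add[OF I_antimono[OF power_sum_bernoulli[OF assms], of 1] this] show ?thesis by simp
qed

definition power_harmonic :: "nat \<Rightarrow> nat \<Rightarrow> rat" where
  "power_harmonic s n = (\<Sum>j=1..n. 1 / of_nat j ^ s)"

lemma power_harmonic_Z: "n < p \<Longrightarrow> power_harmonic s n \<in> Z"
  unfolding power_harmonic_def by (intro Z_sum Z_inverse_power not_dvd_residue) auto

text \<open>Modulo \<open>p\<close> the exponent \<open>-s\<close> becomes \<open>p - 1 - s\<close>,
  which lies strictly between \<open>0\<close> and \<open>p - 1\<close>, where power sums
  vanish.\<close>

lemma power_harmonic_I:
  assumes "0 < s" "s < p - 1"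
  shows "power_harmonic s (p - 1) \<in> I 1"
proof -
  have "(\<Sum>j=1..p-1. of_nat j ^ (p - 1 - s) - 1 / of_nat j ^ s) \<in> I 1"
    using assms by (intro I_sum fermat_inverse not_dvd_residue) auto
  moreover have "(\<Sum>j=1..p-1. of_nat j ^ (p - 1 - s)) \<in> I 1"
    using assms by (intro power_sum_I) auto
  ultimately have "(\<Sum>j=1..p-1. of_nat j ^ (p - 1 - s))
      - (\<Sum>j=1..p-1. of_nat j ^ (p - 1 - s) - 1 / of_nat j ^ s) \<in> I 1"
    by (intro I_diff)
  then show ?thesis by (simp add: power_harmonic_def sum_subtractf)
qed

section \<open>Reflection of residues\<close>

lemma sum_reflect: "(\<Sum>j=1..p-1. f (p - j)) = (\<Sum>j=1..p-1. f j)"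
  by (rule sum.reindex_bij_witness[of _ "\<lambda>j. p - j" "\<lambda>j. p - j"]) auto

lemma reflection_harmonic:
  "2 * power_harmonic 1 (p - 1) + of_nat p * power_harmonic 2 (p - 1) + of_nat p ^ 2 * power_harmonic 3 (p - 1)
    + of_nat p ^ 3 * power_harmonic 4 (p - 1) + of_nat p ^ 4 * power_harmonic 5 (p - 1) \<in> I 5"
proof -
  let ?P = "of_nat p :: rat"
  have "1 / of_nat (p - j) + (1 / of_nat j + ?P * (1 / of_nat j ^ 2) + ?P ^ 2 * (1 / of_nat j ^ 3)
      + ?P ^ 3 * (1 / of_nat j ^ 4) + ?P ^ 4 * (1 / of_nat j ^ 5)) \<in> I 5" if j: "j \<in> {1..p-1}" for j
  proof -
    \<comment> \<open>The geometric series of \<open>1 / (P - x)\<close> in powers of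
      \<open>P / x\<close>, cut after five terms with its exact remainder.\<close>
    have *: "1 / (P - x) + (1 / x + P * (1 / x ^ 2) + P ^ 2 * (1 / x ^ 3) + P ^ 3 * (1 / x ^ 4) + P ^ 4 * (1 / x ^ 5))
      = P ^ 5 * (1 / x ^ 5 * (1 / (P - x)))" if "x \<noteq> 0" "P - x \<noteq> 0" for x P :: rat
      using that by (simp add: divide_simps) (simp add: algebra_simps eval_nat_numeral)
    have "j \<le> p" and nz: "(of_nat j :: rat) \<noteq> 0" "?P - of_nat j \<noteq> 0" using j by auto
    have "1 / of_nat j ^ 5 * (1 / of_nat (p - j)) \<in> Z"
      using j by (intro Z_mult Z_inverse_power Z_inverse_of_nat not_dvd_residue) auto
    then have "?P ^ 5 * (1 / of_nat j ^ 5 * (1 / of_nat (p - j))) \<in> I 5"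
      by (intro p_multiple_I) auto
    then show ?thesis using *[OF nz] \<open>j \<le> p\<close> by (simp add: of_nat_diff)
  qed
  then have "(\<Sum>j=1..p-1. 1 / of_nat (p - j) + (1 / of_nat j + ?P * (1 / of_nat j ^ 2) + ?P ^ 2 * (1 / of_nat j ^ 3)
      + ?P ^ 3 * (1 / of_nat j ^ 4) + ?P ^ 4 * (1 / of_nat j ^ 5))) \<in> I 5"
    by (rule I_sum)
  then show ?thesis
    unfolding power_harmonic_def
    unfolding sum.distrib sum_distrib_left[symmetric] sum_reflect[of "\<lambda>j. 1 / of_nat j"]
    by (simp add: add_ac)
qed

lemma reflection_harmonic_3:
  "2 * power_harmonic 3 (p - 1) + 3 * of_nat p * power_harmonic 4 (p - 1)
    + 6 * of_nat p ^ 2 * power_harmonic 5 (p - 1) \<in> I 3"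
proof -
  let ?P = "of_nat p :: rat"
  have "1 / of_nat (p - j) ^ 3 + (1 / of_nat j ^ 3 + 3 * ?P * (1 / of_nat j ^ 4)
      + 6 * ?P ^ 2 * (1 / of_nat j ^ 5)) \<in> I 3" if j: "j \<in> {1..p-1}" for j
  proof -
    \<comment> \<open>The coefficients 1, 3, 6 are those of \<open>(1 - P/x)^(-3)\<close>; the
      quadratic factor comes from \<open>x^5 + (P - x)^3 * (x^2 + 3*x*P + 6*P^2) = P^3 * (10*x^2 -
      15*x*P + 6*P^2)\<close>.\<close>
    have *: "1 / (P - x) ^ 3 + (1 / x ^ 3 + 3 * P * (1 / x ^ 4) + 6 * P ^ 2 * (1 / x ^ 5))
      = P ^ 3 * (1 / x ^ 5 * (1 / (P - x) ^ 3) * (10 * x ^ 2 - 15 * x * P + 6 * P ^ 2))"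
      if "x \<noteq> 0" "P - x \<noteq> 0" for x P :: rat
      using that by (simp add: divide_simps) (simp add: algebra_simps eval_nat_numeral)
    have "j \<le> p" and nz: "(of_nat j :: rat) \<noteq> 0" "?P - of_nat j \<noteq> 0" using j by auto
    have "1 / of_nat j ^ 5 * (1 / of_nat (p - j) ^ 3)
        * (10 * of_nat j ^ 2 - 15 * of_nat j * ?P + 6 * ?P ^ 2) \<in> Z"
      using j by (intro Z_mult Z_diff Z_add Z_power Z_inverse_power not_dvd_residue) auto
    then have "?P ^ 3 * (1 / of_nat j ^ 5 * (1 / of_nat (p - j) ^ 3)
        * (10 * of_nat j ^ 2 - 15 * of_nat j * ?P + 6 * ?P ^ 2)) \<in> I 3"
      by (intro p_multiple_I) auto
    then show ?thesis using *[OF nz] \<open>j \<le> p\<close> by (simp only: of_nat_diff)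
  qed
  then have "(\<Sum>j=1..p-1. 1 / of_nat (p - j) ^ 3 + (1 / of_nat j ^ 3 + 3 * ?P * (1 / of_nat j ^ 4)
      + 6 * ?P ^ 2 * (1 / of_nat j ^ 5))) \<in> I 3"
    by (rule I_sum)
  then show ?thesis
    unfolding power_harmonic_def
    unfolding sum.distrib sum_distrib_left[symmetric] sum_reflect[of "\<lambda>j. 1 / of_nat j ^ 3"]
    by (simp add: add_ac)
qed

section \<open>Products in powers of p\<close>

text \<open>The coefficients are the first two elementary symmetric functions of the numbers
  \<open>1 / i^2\<close>, written in power sums by Newton's identity; the half in it is p-integral
  because \<open>p\<close> is odd.\<close>

lemma product_expansion:
  assumes "2 < p" "n < p"
  shows "(\<Prod>i=1..n. 1 - (of_nat p)\<^sup>2 / (of_nat i)\<^sup>2)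
    - (1 - of_nat p ^ 2 * power_harmonic 2 n
        + of_nat p ^ 4 * ((power_harmonic 2 n ^ 2 - power_harmonic 4 n) / 2)) \<in> I 6"
  using assms(2)
proof (induction n)
  case 0
  then show ?case by (simp add: power_harmonic_def)
next
  case (Suc n)
  let ?P = "of_nat p :: rat"
  define b where "b = (\<Prod>i=1..n. 1 - ?P\<^sup>2 / (of_nat i)\<^sup>2)"
  define s where "s = power_harmonic 2 n"
  define t where "t = power_harmonic 4 n"
  define u :: rat where "u = 1 / of_nat (Suc n) ^ 2"
  have u: "u \<in> Z" unfolding u_def using Suc.prems by (intro Z_inverse_power not_dvd_residue) auto
  have "(s ^ 2 - t) / of_nat 2 \<in> Z"
    using Suc.prems assms(1) by (intro Z_divide_of_nat) (auto simp: s_def t_def power_harmonic_Z dest: dvd_imp_le)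
  then have e2: "(s ^ 2 - t) / 2 \<in> Z" by simp
  have "b - (1 - ?P ^ 2 * s + ?P ^ 4 * ((s ^ 2 - t) / 2)) \<in> I 6"
    using Suc by (simp add: b_def s_def t_def)
  \<comment> \<open>The truncation times the new factor \<open>1 - ?P ^ 2 * u\<close> has exactly
    one term of order \<open>p^6\<close>, which is removed here.\<close>
  then have "(b - (1 - ?P ^ 2 * s + ?P ^ 4 * ((s ^ 2 - t) / 2))) * (1 - ?P ^ 2 * u)
      - ?P ^ 6 * ((s ^ 2 - t) / 2 * u) \<in> I 6"
    using u e2 by (intro I_diff[OF I_mult_Z p_multiple_I] Z_mult Z_diff Z_power) auto
  also have "(b - (1 - ?P ^ 2 * s + ?P ^ 4 * ((s ^ 2 - t) / 2))) * (1 - ?P ^ 2 * u)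
      - ?P ^ 6 * ((s ^ 2 - t) / 2 * u)
    = b * (1 - ?P ^ 2 * u) - (1 - ?P ^ 2 * (s + u) + ?P ^ 4 * (((s + u) ^ 2 - (t + u ^ 2)) / 2))"
    by (simp add: field_simps eval_nat_numeral)
  also have "b * (1 - ?P ^ 2 * u) = (\<Prod>i=1..Suc n. 1 - ?P\<^sup>2 / (of_nat i)\<^sup>2)"
    by (simp add: b_def u_def)
  also have "s + u = power_harmonic 2 (Suc n)"
    by (simp add: s_def u_def power_harmonic_def)
  also have "t + u ^ 2 = power_harmonic 4 (Suc n)"
    by (simp add: t_def u_def power_harmonic_def power_one_over power_mult[symmetric])
  finally show ?case .
qed

lemma square_product_expansion:
  assumes "2 < p" "n < p"
  shows "(\<Prod>i=1..n. 1 - (of_nat p)\<^sup>2 / (of_nat i)\<^sup>2)\<^sup>2 - (1 - 2 * of_nat p ^ 2 * power_harmonic 2 n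
    + of_nat p ^ 4 * (2 * power_harmonic 2 n ^ 2 - power_harmonic 4 n)) \<in> I 6"
proof -
  let ?P = "of_nat p :: rat"
  define b where "b = (\<Prod>i=1..n. 1 - ?P\<^sup>2 / (of_nat i)\<^sup>2)"
  define s where "s = power_harmonic 2 n"
  define t where "t = power_harmonic 4 n"
  define e where "e = (s ^ 2 - t) / 2"
  have s: "s \<in> Z" using assms by (simp add: s_def power_harmonic_Z)
  have "(s ^ 2 - t) / of_nat 2 \<in> Z"
    using assms by (intro Z_divide_of_nat) (auto simp: s_def t_def power_harmonic_Z dest: dvd_imp_le)
  then have e: "e \<in> Z" by (simp add: e_def)
  define d where "d = b - (1 - ?P ^ 2 * s + ?P ^ 4 * e)"
  have d: "d \<in> I 6" using product_expansion[OF assms] by (simp add: d_def b_def s_def t_def e_def)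
  then have dZ: "d \<in> Z" using I_antimono[of d 6 0] by (simp add: I_eq_Z)
  \<comment> \<open>With \<open>T\<close> the truncation of \<open>b\<close>,
    \<open>b^2 - T^2 = d * (d + 2*T)\<close>; the second summand collects the terms of
    \<open>T^2\<close> from order \<open>p^6\<close> on.\<close>
  have "d * (d + 2 * (1 - ?P ^ 2 * s + ?P ^ 4 * e)) + ?P ^ 6 * (?P ^ 2 * e ^ 2 - 2 * s * e) \<in> I 6"
    using dZ s e by (intro I_add[OF I_mult_Z[OF d] p_multiple_I]) auto
  also have "d * (d + 2 * (1 - ?P ^ 2 * s + ?P ^ 4 * e)) + ?P ^ 6 * (?P ^ 2 * e ^ 2 - 2 * s * e)
      = b\<^sup>2 - (1 - 2 * ?P ^ 2 * s + ?P ^ 4 * (2 * e + s ^ 2))"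
    unfolding d_def by (simp add: algebra_simps eval_nat_numeral)
  also have "2 * e + s ^ 2 = 2 * s ^ 2 - t"
    by (simp add: e_def)
  finally show ?thesis by (simp add: b_def s_def t_def)
qed

section \<open>Doubling of residues and H(4) modulo p^2\<close>

text \<open>Doubling permutes the nonzero residues: the lower half of the \<open>i\<close> yields
  the even ones, the upper half, reduced by \<open>p\<close>, the odd ones.\<close>

lemma sum_double_residues:
  assumes "odd p"
  shows "(\<Sum>j=1..p-1. f j) = (\<Sum>i=1..(p-1) div 2. f (2 * i)) + (\<Sum>i=(p-1) div 2+1..p-1. f (2 * i - p))"
proof -
  obtain h where h: "p = 2 * h + 1" using assms by (auto elim: oddE)
  have "(\<Sum>j=1..p-1. f j) = (\<Sum>j | j \<in> {1..p-1} \<and> even j. f j) + (\<Sum>j | j \<in> {1..p-1} \<and> odd j. f j)"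
    by (subst sum.union_disjoint[symmetric]) (auto intro!: sum.cong)
  also have "(\<Sum>j | j \<in> {1..p-1} \<and> even j. f j) = (\<Sum>i=1..h. f (2 * i))"
    by (rule sum.reindex_bij_witness[of _ "\<lambda>i. 2 * i" "\<lambda>j. j div 2"]) (auto simp: h)
  also have "(\<Sum>j | j \<in> {1..p-1} \<and> odd j. f j) = (\<Sum>i=h+1..p-1. f (2 * i - p))"
    by (rule sum.reindex_bij_witness[of _ "\<lambda>i. 2 * i - p" "\<lambda>j. (j + p) div 2"]) (auto simp: h elim!: oddE)
  finally show ?thesis by (simp add: h)
qed

text \<open>Here \<open>g\<close> acts as minus the derivative of \<open>f\<close> modulo
  \<open>p\<close>. Only the upper half of the doubled residues is shifted by \<open>p\<close>, so
  the linear correction runs over that half.\<close>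

lemma sum_double_residues_cong:
  fixes f g :: "nat \<Rightarrow> rat"
  assumes "odd p"
    and shift: "\<And>x. \<not> p dvd x \<Longrightarrow> p < x \<Longrightarrow> f (x - p) - f x - of_nat p * g x \<in> I 2"
  shows "(\<Sum>j=1..p-1. f j) - (\<Sum>i=1..p-1. f (2 * i))
    - of_nat p * (\<Sum>i=(p-1) div 2+1..p-1. g (2 * i)) \<in> I 2"
proof -
  have nd: "\<not> p dvd 2 * i" if "i \<in> {1..p-1}" for i
    using that assms(1) prime not_dvd_residue[of i] primes_dvd_imp_eq[OF prime two_is_prime_nat]
    by (auto simp: prime_dvd_mult_iff)
  have "{1..p-1} = {1..(p-1) div 2} \<union> {(p-1) div 2+1..p-1}" by auto
  then have "(\<Sum>i=1..p-1. f (2 * i))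
      = (\<Sum>i=1..(p-1) div 2. f (2 * i)) + (\<Sum>i=(p-1) div 2+1..p-1. f (2 * i))"
    by (simp add: sum.union_disjoint)
  then have "(\<Sum>j=1..p-1. f j) - (\<Sum>i=1..p-1. f (2 * i))
      - of_nat p * (\<Sum>i=(p-1) div 2+1..p-1. g (2 * i))
    = (\<Sum>i=(p-1) div 2+1..p-1. f (2 * i - p) - f (2 * i) - of_nat p * g (2 * i))"
    unfolding sum_double_residues[OF assms(1), of f]
    by (simp add: sum_subtractf sum_distrib_left)
  also have "\<dots> \<in> I 2"
    using assms(1) by (intro I_sum shift nd) (auto elim!: oddE)
  finally show ?thesis .
qed

lemma power_shift_I: "(of_nat x - of_nat p) ^ Suc m - of_nat x ^ Suc m
    + of_nat p * (of_nat (Suc m) * of_nat x ^ m) \<in> I 2"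
proof (induction m)
  case (Suc m)
  let ?x = "of_nat x :: rat" and ?P = "of_nat p :: rat"
  have "((?x - ?P) ^ Suc m - ?x ^ Suc m + ?P * (of_nat (Suc m) * ?x ^ m)) * (?x - ?P)
      + ?P ^ 2 * (of_nat (Suc m) * ?x ^ m) \<in> I 2"
    by (intro I_add[OF I_mult_Z[OF Suc] p_multiple_I]) auto
  also have "((?x - ?P) ^ Suc m - ?x ^ Suc m + ?P * (of_nat (Suc m) * ?x ^ m)) * (?x - ?P)
      + ?P ^ 2 * (of_nat (Suc m) * ?x ^ m)
    = (?x - ?P) ^ Suc (Suc m) - ?x ^ Suc (Suc m) + ?P * (of_nat (Suc (Suc m)) * ?x ^ Suc m)"
    by (simp add: algebra_simps power2_eq_square)
  finally show ?case .
qed simp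

text \<open>Modulo \<open>p\<close> the exponents \<open>-4\<close> and \<open>p - 5\<close> agree. Splitting the residues into even ones \<open>2i\<close> and
  odd ones \<open>2i - p\<close> expresses both power sums modulo \<open>p\<^sup>2\<close> through one sum, with factors \<open>4\<close> and \<open>5\<close>
  coming from the derivatives of \<open>x\<close> to these exponents; this replaces Kummer's congruence.\<close>

lemma power_harmonic_4_bernoulli:
  assumes "p \<ge> 7"
  shows "power_harmonic 4 (p - 1) - 4 / 5 * (of_nat p * bernoulli (p - 5)) \<in> I 2"
proof -
  let ?P = "of_nat p :: rat"
  have odd: "odd p" using assms prime prime_odd_nat[of p] by auto
  define h4 where "h4 = power_harmonic 4 (p - 1)"
  define N :: rat where "N = (\<Sum>j=1..p-1. of_nat j ^ (p - 5))"
  define Y :: rat where "Y = (\<Sum>i=(p-1) div 2+1..p-1. 1 / of_nat (2 * i) ^ 5)"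
  have "(\<Sum>j=1..p-1. 1 / of_nat j ^ 4) - (\<Sum>i=1..p-1. 1 / of_nat (2 * i) ^ 4)
    - ?P * (\<Sum>i=(p-1) div 2+1..p-1. 4 * (1 / of_nat (2 * i) ^ 5)) \<in> I 2"
  proof (rule sum_double_residues_cong[OF odd])
    fix x assume x: "\<not> p dvd x" "p < x"
    \<comment> \<open>The exact remainder after the linear term, from
      \<open>x^5 - (x - P)^4 * (x + 4*P)\<close>, which is divisible by \<open>P^2\<close>.\<close>
    have *: "1 / (x - P) ^ 4 - 1 / x ^ 4 - P * (4 * (1 / x ^ 5))
      = P ^ 2 * (1 / x ^ 5 * (1 / (x - P) ^ 4) * (10 * x ^ 3 - 20 * x ^ 2 * P + 15 * x * P ^ 2 - 4 * P ^ 3))"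
      if "x \<noteq> 0" "x - P \<noteq> 0" for x P :: rat
      using that by (simp add: divide_simps) (simp add: algebra_simps eval_nat_numeral)
    have nz: "(of_nat x :: rat) \<noteq> 0" "of_nat x - ?P \<noteq> 0" using x by auto
    have "\<not> p dvd x - p" using x by (metis dvd_diffD less_imp_le dvd_refl)
    then have "1 / of_nat x ^ 5 * (1 / of_nat (x - p) ^ 4)
        * (10 * of_nat x ^ 3 - 20 * of_nat x ^ 2 * ?P + 15 * of_nat x * ?P ^ 2 - 4 * ?P ^ 3) \<in> Z"
      using x by (intro Z_mult Z_diff Z_add Z_power Z_inverse_power) auto
    then have "?P ^ 2 * (1 / of_nat x ^ 5 * (1 / of_nat (x - p) ^ 4)
        * (10 * of_nat x ^ 3 - 20 * of_nat x ^ 2 * ?P + 15 * of_nat x * ?P ^ 2 - 4 * ?P ^ 3)) \<in> I 2"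
      by (intro p_multiple_I) auto
    then show "1 / of_nat (x - p) ^ 4 - 1 / of_nat x ^ 4 - ?P * (4 * (1 / of_nat x ^ 5)) \<in> I 2"
      using *[OF nz] x by (simp only: of_nat_diff less_imp_le)
  qed
  also have "(\<Sum>i=1..p-1. 1 / of_nat (2 * i) ^ 4) = 1 / 16 * h4"
    unfolding h4_def power_harmonic_def sum_distrib_left
    by (intro sum.cong) (simp_all add: power_mult_distrib)
  finally have 1: "h4 - 1 / 16 * h4 - ?P * (4 * Y) \<in> I 2"
    unfolding sum_distrib_left[symmetric] Y_def[symmetric]
    unfolding power_harmonic_def[symmetric] h4_def[symmetric] .
  have p6: "Suc (p - 6) = p - 5" "p - 1 - 5 = p - 6" "p - 1 - 4 = p - 5" using assms by auto
  have "(\<Sum>j=1..p-1. of_nat j ^ (p - 5)) - (\<Sum>i=1..p-1. of_nat (2 * i) ^ (p - 5))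
    - ?P * (\<Sum>i=(p-1) div 2+1..p-1. 5 * (1 / of_nat (2 * i) ^ 5)) \<in> I 2"
  proof (rule sum_double_residues_cong[OF odd])
    fix x assume x: "\<not> p dvd x" "p < x"
    \<comment> \<open>The linear coefficient is \<open>-(p - 5)\<close>, congruent to
      \<open>5\<close> modulo \<open>p\<close>. Fact \<open>c\<close> removes the difference, and
      \<open>b\<close> replaces \<open>x^(p - 6)\<close> by \<open>1 / x^5\<close>, both at the cost
      of a multiple of \<open>p^2\<close>.\<close>
    have a: "(of_nat x - ?P) ^ (p - 5) - of_nat x ^ (p - 5) + ?P * (of_nat (p - 5) * of_nat x ^ (p - 6)) \<in> I 2"
      using power_shift_I[of x "p - 6"] by (simp only: p6)
    have "of_nat x ^ (p - 6) - 1 / of_nat x ^ 5 \<in> I 1"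
      using fermat_inverse[OF x(1), of 5] assms by (simp only: p6)
    then have b: "?P ^ 1 * (5 * (of_nat x ^ (p - 6) - 1 / of_nat x ^ 5)) \<in> I 2"
      by (rule I_p_power_mult[OF I_Z_mult[OF Z_numeral]]) simp
    have c: "?P ^ 2 * of_nat x ^ (p - 6) \<in> I 2" by (intro p_multiple_I) auto
    have "((of_nat x - ?P) ^ (p - 5) - of_nat x ^ (p - 5) + ?P * (of_nat (p - 5) * of_nat x ^ (p - 6)))
        + ?P ^ 1 * (5 * (of_nat x ^ (p - 6) - 1 / of_nat x ^ 5)) - ?P ^ 2 * of_nat x ^ (p - 6) \<in> I 2"
      using I_diff[OF I_add[OF a b] c] .
    also have "((of_nat x - ?P) ^ (p - 5) - of_nat x ^ (p - 5) + ?P * (of_nat (p - 5) * of_nat x ^ (p - 6)))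
        + ?P ^ 1 * (5 * (of_nat x ^ (p - 6) - 1 / of_nat x ^ 5)) - ?P ^ 2 * of_nat x ^ (p - 6)
      = of_nat (x - p) ^ (p - 5) - of_nat x ^ (p - 5) - ?P * (5 * (1 / of_nat x ^ 5))"
      using x assms by (simp add: of_nat_diff algebra_simps power2_eq_square)
    finally show "of_nat (x - p) ^ (p - 5) - of_nat x ^ (p - 5) - ?P * (5 * (1 / of_nat x ^ 5)) \<in> I 2" .
  qed
  also have "(\<Sum>i=1..p-1. of_nat (2 * i) ^ (p - 5)) = 2 ^ (p - 5) * N"
    by (simp add: N_def sum_distrib_left power_mult_distrib)
  finally have 2: "N - 2 ^ (p - 5) * N - ?P * (5 * Y) \<in> I 2"
    unfolding sum_distrib_left[symmetric] Y_def[symmetric] N_def[symmetric] .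
  \<comment> \<open>As \<open>N\<close> is divisible by \<open>p\<close>, knowing
    \<open>2^(p - 5)\<close> modulo \<open>p\<close> is enough for its product with \<open>N\<close>
    modulo \<open>p^2\<close>.\<close>
  have "\<not> p dvd 2" using assms by (auto dest: dvd_imp_le)
  from fermat_inverse[OF this, of 4] have "2 ^ (p - 5) - 1 / 16 \<in> I 1"
    using assms by (simp add: p6)
  moreover have "N \<in> I 1" unfolding N_def using assms by (intro power_sum_I) auto
  ultimately have "(2 ^ (p - 5) - 1 / 16) * N \<in> I (1 + 1)" by (rule I_mult)
  then have 3: "(2 ^ (p - 5) - 1 / 16) * N \<in> I 2" by (simp only: one_add_one)
  have 4: "N - ?P * bernoulli (p - 5) \<in> I 2"
    unfolding N_def using assms by (intro power_sum_bernoulli) auto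
  have nd: "\<not> p dvd 5" using assms by (auto dest: dvd_imp_le)
  then have Z5: "1 / 5 \<in> Z" using Z_inverse_of_nat[of 5] by simp
  have "\<not> p dvd 3" using assms by (auto dest: dvd_imp_le)
  with nd have "\<not> p dvd 3 * 5" using prime_dvd_multD[OF prime] by blast
  then have Z15: "1 / 15 \<in> Z" using Z_inverse_of_nat[of 15] by simp
  \<comment> \<open>Elimination of \<open>Y\<close>: modulo \<open>p^2\<close>,
    \<open>15/16 * h4\<close> is \<open>4*p*Y\<close> and \<open>15/16 * N\<close> is
    \<open>5*p*Y\<close>, so \<open>h4\<close> is \<open>4/5 * N\<close>. This needs
    \<open>3\<close> and \<open>5\<close> to be invertible.\<close>
  have "16 * (1 / 15) * ((h4 - 1 / 16 * h4 - ?P * (4 * Y))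
      - 4 * (1 / 5) * ((N - 2 ^ (p - 5) * N - ?P * (5 * Y)) + (2 ^ (p - 5) - 1 / 16) * N))
      + 4 * (1 / 5) * (N - ?P * bernoulli (p - 5)) \<in> I 2"
    by (intro I_add[OF I_Z_mult[OF _ I_diff[OF 1 I_Z_mult[OF _ I_add[OF 2 3]]]] I_Z_mult[OF _ 4]]
        Z_mult Z5 Z15 Z_numeral)
  also have "16 * (1 / 15) * ((h4 - 1 / 16 * h4 - ?P * (4 * Y))
      - 4 * (1 / 5) * ((N - 2 ^ (p - 5) * N - ?P * (5 * Y)) + (2 ^ (p - 5) - 1 / 16) * N))
      + 4 * (1 / 5) * (N - ?P * bernoulli (p - 5)) = h4 - 4 / 5 * (?P * bernoulli (p - 5))"
    by (simp add: field_simps)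
  finally show ?thesis by (simp add: h4_def)
qed

section \<open>The double sum modulo p\<close>

text \<open>Replace \<open>1 / i^2\<close> by \<open>i^(p - 3)\<close> and apply Faulhaber's formula
  to the inner sum. Of the resulting power sums over \<open>j\<close>, only the one with exponent
  \<open>0\<close>, at \<open>k = p - 5\<close>, survives modulo \<open>p\<close>.\<close>

lemma double_sum_bernoulli:
  assumes "p \<ge> 7"
  shows "(\<Sum>j=1..p-1. power_harmonic 2 (j - 1) / of_nat j ^ 3) + 2 * bernoulli (p - 5) \<in> I 1"
proof -
  let ?P = "of_nat p :: rat"
  define W where "W = (\<Sum>j=1..p-1. power_harmonic 2 (j - 1) / of_nat j ^ 3)"
  define U :: rat where "U = (\<Sum>j=1..p-1. (\<Sum>i<j. of_nat i ^ (p - 3)) * (1 / of_nat j ^ 3))"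
  define B where "B = bernoulli (p - 5)"
  have B: "B \<in> Z" unfolding B_def using assms by (intro bernoulli_Z) auto
  have W: "W \<in> Z" unfolding W_def
    by (intro Z_sum) (use Z_mult[OF power_harmonic_Z Z_inverse_power[OF not_dvd_residue]] in fastforce)
  have exps: "p - 1 - 2 = p - 3" "Suc (p - 3) = p - 2" using assms by auto
  have "(\<Sum>i<j. of_nat i ^ (p - 3)) * (1 / of_nat j ^ 3) - power_harmonic 2 (j - 1) / of_nat j ^ 3 \<in> I 1"
    if j: "j \<in> {1..p-1}" for j
  proof -
    \<comment> \<open>Faulhaber's formula starts at \<open>i = 0\<close>, where the positive power
      \<open>p - 3\<close> contributes nothing.\<close>
    have "{..<j} = insert 0 {1..j-1}" using j by auto
    then have "(\<Sum>i<j. of_nat i ^ (p - 3)) = (\<Sum>i=1..j-1. of_nat i ^ (p - 3) :: rat)"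
      using assms by (simp add: zero_power)
    then have "(\<Sum>i<j. of_nat i ^ (p - 3)) - power_harmonic 2 (j - 1)
        = (\<Sum>i=1..j-1. of_nat i ^ (p - 3) - 1 / of_nat i ^ 2)"
      by (simp add: power_harmonic_def sum_subtractf)
    also have "\<dots> \<in> I 1"
    proof (rule I_sum)
      fix i assume "i \<in> {1..j-1}"
      then have "\<not> p dvd i" using j by (intro not_dvd_residue) auto
      from fermat_inverse[OF this, of 2] show "of_nat i ^ (p - 3) - 1 / of_nat i ^ 2 \<in> I 1"
        using assms by (simp only: exps)
    qed
    finally have "((\<Sum>i<j. of_nat i ^ (p - 3)) - power_harmonic 2 (j - 1)) * (1 / of_nat j ^ 3) \<in> I 1"
      using j by (intro I_mult_Z Z_inverse_power not_dvd_residue)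
    then show ?thesis by (simp add: diff_divide_distrib)
  qed
  then have UW: "U - W \<in> I 1"
    unfolding U_def W_def sum_subtractf[symmetric] by (rule I_sum)
  \<comment> \<open>The power sum with exponent \<open>p - 5 - k\<close>, kept as a product since
    that exponent is \<open>-1\<close> and \<open>-2\<close> for the last two \<open>k\<close>,
    where it is a harmonic sum.\<close>
  define s :: "nat \<Rightarrow> rat" where "s k = (\<Sum>j=1..p-1. of_nat j ^ (p - 2 - k) * (1 / of_nat j ^ 3))" for k
  have "of_nat (p - 2) * U
      = (\<Sum>j=1..p-1. (\<Sum>k\<le>p-3. of_nat (p - 2 choose k) * bernoulli k * of_nat j ^ (p - 2 - k)) * (1 / of_nat j ^ 3))"
    using bernoulli_faulhaber[of "p - 3"]
    unfolding U_def sum_distrib_left[of _ _ "{1..p-1}"] exps mult.assoc[symmetric] by simp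
  also have "\<dots> = (\<Sum>k\<le>p-3. of_nat (p - 2 choose k) * bernoulli k * s k)"
    unfolding s_def sum_distrib_left sum_distrib_right
    by (subst sum.swap) (simp add: mult.assoc)
  finally have U: "of_nat (p - 2) * U = (\<Sum>k\<le>p-3. of_nat (p - 2 choose k) * bernoulli k * s k)" .
  have s_eq: "s (p - 5) = of_nat (p - 1)"
  proof -
    have "p - 2 - (p - 5) = 3" using assms by auto
    then have "s (p - 5) = (\<Sum>j=1..p-1. 1)" unfolding s_def by (intro sum.cong) auto
    then show ?thesis by simp
  qed
  have s_I: "s k \<in> I 1" if "k \<le> p - 3" "k \<noteq> p - 5" for k
  proof -
    have "k < p - 5 \<or> k = p - 4 \<or> k = p - 3" using that assms by linarith
    then consider "k < p - 5" | "k = p - 4" | "k = p - 3" by blast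
    then show ?thesis
    proof cases
      case 1
      then have e: "p - 2 - k = (p - 5 - k) + 3" by auto
      have "s k = (\<Sum>j=1..p-1. of_nat j ^ (p - 5 - k))"
        unfolding s_def e power_add by (intro sum.cong refl) simp
      moreover have "(\<Sum>j=1..p-1. of_nat j ^ (p - 5 - k)) \<in> I 1"
        using 1 by (intro power_sum_I) auto
      ultimately show ?thesis by (simp only:)
    next
      case 2
      then have e: "p - 2 - k = 2" using assms by linarith
      have "s k = power_harmonic 1 (p - 1)"
        unfolding s_def power_harmonic_def e by (intro sum.cong refl) (simp add: eval_nat_numeral)
      moreover have "\<dots> \<in> I 1" using assms by (intro power_harmonic_I) auto
      ultimately show ?thesis by (simp only:)
    next
      case 3
      then have e: "p - 2 - k = 1" using assms by linarith
      have "s k = power_harmonic 2 (p - 1)"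
        unfolding s_def power_harmonic_def e by (intro sum.cong refl) (simp add: eval_nat_numeral)
      moreover have "\<dots> \<in> I 1" using assms by (intro power_harmonic_I) auto
      ultimately show ?thesis by (simp only:)
    qed
  qed
  have "of_nat (p - 2) * U - of_nat (p - 2 choose (p - 5)) * B * of_nat (p - 1)
      = (\<Sum>k\<in>{..p-3} - {p - 5}. of_nat (p - 2 choose k) * bernoulli k * s k)"
    unfolding U by (subst sum.remove[of _ "p - 5"]) (auto simp: s_eq B_def)
  also have "\<dots> \<in> I 1"
    by (intro I_sum I_Z_mult Z_mult bernoulli_Z s_I) (use assms in auto)
  finally have D: "of_nat (p - 2) * U - of_nat (p - 2 choose (p - 5)) * B * of_nat (p - 1) \<in> I 1" .
  have "p - 2 choose (p - 5) = p - 2 choose 3"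
    using binomial_symmetric[of 3 "p - 2"] assms by (simp add: numeral_eq_Suc)
  moreover have "3 * (p - 2 choose 3) = (p - 2) * (p - 3 choose 2)"
    using binomial_absorption[of 2 "p - 2"] by (simp add: numeral_eq_Suc)
  moreover have "2 * (p - 3 choose 2) = (p - 3) * (p - 4)"
    using binomial_absorption[of 1 "p - 3"] by (simp add: numeral_eq_Suc)
  then have "2 * ((p - 2) * (p - 3 choose 2)) = (p - 2) * (p - 3) * (p - 4)"
    by (metis mult.assoc mult.commute)
  ultimately have "6 * (p - 2 choose (p - 5)) = (p - 2) * (p - 3) * (p - 4)"
    by linarith
  then have "of_nat (6 * (p - 2 choose (p - 5))) = (of_nat ((p - 2) * (p - 3) * (p - 4)) :: rat)" by simp
  then have ch: "6 * of_nat (p - 2 choose (p - 5)) = (?P - 2) * (?P - 3) * (?P - 4)"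
    using assms by (simp add: of_nat_diff)
  \<comment> \<open>Modulo \<open>p\<close> the product is \<open>4! = 24\<close>; the explicit
    multiple of \<open>p\<close> is cancelled in the combination below.\<close>
  have "(?P - 1) * (?P - 2) * (?P - 3) * (?P - 4) = ?P * (?P ^ 3 - 10 * ?P ^ 2 + 35 * ?P - 50) + 24"
    by (simp add: algebra_simps eval_nat_numeral)
  then have ch': "6 * of_nat (p - 2 choose (p - 5)) * (?P - 1) = ?P * (?P ^ 3 - 10 * ?P ^ 2 + 35 * ?P - 50) + 24"
    unfolding ch by (simp add: mult_ac)
  have "?P ^ 1 * (6 * W - (?P ^ 3 - 10 * ?P ^ 2 + 35 * ?P - 50) * B) \<in> I 1"
    using W B by (intro p_multiple_I) auto
  \<comment> \<open>The \<open>num\<close> term is the numeral 6. Modulo \<open>p\<close> the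
    combination says \<open>-12 * W = 24 * B\<close>, and \<open>12\<close> is invertible.\<close>
  from I_diff[OF this I_Z_mult[OF Z_numeral[of "num.Bit0 (num.Bit1 num.One)"] I_diff[OF D I_Z_mult[OF Z_of_nat[of "p - 2"] UW]]]]
  have "?P * (6 * W - (?P ^ 3 - 10 * ?P ^ 2 + 35 * ?P - 50) * B)
     - 6 * (of_nat (p - 2) * U - of_nat (p - 2 choose (p - 5)) * B * of_nat (p - 1) - of_nat (p - 2) * (U - W)) \<in> I 1"
    by simp
  also have "?P * (6 * W - (?P ^ 3 - 10 * ?P ^ 2 + 35 * ?P - 50) * B)
     - 6 * (of_nat (p - 2) * U - of_nat (p - 2 choose (p - 5)) * B * of_nat (p - 1) - of_nat (p - 2) * (U - W))
    = ?P * (6 * W - (?P ^ 3 - 10 * ?P ^ 2 + 35 * ?P - 50) * B)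
     - 6 * (?P - 2) * W + (6 * of_nat (p - 2 choose (p - 5)) * (?P - 1)) * B"
    using assms by (simp add: of_nat_diff algebra_simps)
  also have "\<dots> = of_nat 12 * (W + 2 * B)"
    unfolding ch' by (simp add: algebra_simps)
  finally have "of_nat 12 * (W + 2 * B) \<in> I 1" .
  moreover have "\<not> p dvd 12"
  proof -
    have "\<not> p dvd 2" "\<not> p dvd 3" using assms by (auto dest: dvd_imp_le)
    then have "\<not> p dvd 2 * (2 * 3)" by (simp only: prime_dvd_mult_iff[OF prime] simp_thms)
    then show ?thesis by simp
  qed
  ultimately have "1 / of_nat 12 * (of_nat 12 * (W + 2 * B)) \<in> I 1"
    by (intro I_Z_mult[OF Z_inverse_of_nat])
  also have "1 / of_nat 12 * (of_nat 12 * (W + 2 * B)) = W + 2 * B" by simp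
  finally show ?thesis by (simp only: W_def B_def)
qed

end

section \<open>The supercongruence\<close>

lemma cong_pow_apery_ge_7:
  fixes p :: nat
  assumes "prime p" and p7: "p \<ge> 7"
  shows "cong_pow p 9
           (\<Sum>k=0..p-1. of_nat ((2 * k + 1)^3 * apery k))
           (of_nat p ^ 3 + 4 * of_nat p ^ 4 * harmonic (p - 1)
              + 6 / 5 * of_nat p ^ 8 * bernoulli (p - 5))"
proof -
  interpret prime_localization p using assms(1) by unfold_locales
  let ?P = "of_nat p :: rat"
  define a :: "nat \<Rightarrow> rat" where "a j = (\<Prod>i=1..j. 1 - ?P\<^sup>2 / (of_nat i)\<^sup>2)\<^sup>2" for j
  define V where "V = (\<Sum>j=1..p-1. a (j - 1) / of_nat j ^ 3)"
  define W where "W = (\<Sum>j=1..p-1. power_harmonic 2 (j - 1) / of_nat j ^ 3)"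
  define h where "h s = power_harmonic s (p - 1)" for s
  define B where "B = bernoulli (p - 5)"
  have h1: "harmonic (p - 1) = h 1"
    by (simp add: harmonic_def h_def power_harmonic_def)
  have S: "(\<Sum>k=0..p-1. of_nat ((2 * k + 1)^3 * apery k)) = ?P ^ 2 * (?P * a (p - 1) + ?P ^ 4 * V)"
  proof -
    have p: "Suc (p - 1) = p" "of_nat (p - 1) + 1 = ?P" using p7 by (auto simp: of_nat_diff)
    have "{0..p-1} = {..<p}" using p7 by auto
    then have "(\<Sum>k=0..p-1. of_nat ((2 * k + 1)^3 * apery k))
      = ?P\<^sup>2 * (\<Sum>j<p. (2 * ?P\<^sup>2 / (of_nat j + 1) - 1) * a j)"
      unfolding a_def by (simp only: sum_cube_apery)
    also have "(\<Sum>j<p. (2 * ?P\<^sup>2 / (of_nat j + 1) - 1) * a j)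
      = (2 * ?P\<^sup>2 / ?P - ?P) * a (p - 1) + ?P ^ 4 * V"
      using sum_by_parts_products[of ?P "p - 1"] unfolding p a_def V_def .
    also have "2 * ?P\<^sup>2 / ?P - ?P = ?P" by (simp add: power2_eq_square)
    finally show ?thesis .
  qed
  \<comment> \<open>The exponent \<open>5\<close> needs \<open>5 < p - 1\<close>, hence
    \<open>p \<ge> 7\<close>.\<close>
  have h2: "h 2 \<in> I 1" and h5: "h 5 \<in> I 1"
    unfolding h_def using p7 by (auto intro!: power_harmonic_I simp del: One_nat_def)
  have d1: "a (p - 1) - (1 - 2 * ?P ^ 2 * h 2 - ?P ^ 4 * h 4) \<in> I 6"
  proof -
    have "a (p - 1) - (1 - 2 * ?P ^ 2 * h 2 + ?P ^ 4 * (2 * h 2 ^ 2 - h 4)) \<in> I 6"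
      unfolding a_def h_def using p7 by (intro square_product_expansion) auto
    \<comment> \<open>Both factors \<open>h 2\<close> are divisible by \<open>p\<close>, so this
      term disappears modulo \<open>p^6\<close>, the precision required next to the outer factor
      \<open>p^3\<close>.\<close>
    moreover have "?P ^ 4 * (2 * (h 2 * h 2)) \<in> I 6"
      by (rule I_p_power_mult[OF I_Z_mult[OF Z_numeral I_mult[OF h2 h2]]]) simp
    ultimately have "a (p - 1) - (1 - 2 * ?P ^ 2 * h 2 + ?P ^ 4 * (2 * h 2 ^ 2 - h 4))
        + ?P ^ 4 * (2 * (h 2 * h 2)) \<in> I 6"
      by (rule I_add)
    also have "a (p - 1) - (1 - 2 * ?P ^ 2 * h 2 + ?P ^ 4 * (2 * h 2 ^ 2 - h 4))
        + ?P ^ 4 * (2 * (h 2 * h 2)) = a (p - 1) - (1 - 2 * ?P ^ 2 * h 2 - ?P ^ 4 * h 4)"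
      by (simp add: algebra_simps power2_eq_square)
    finally show ?thesis .
  qed
  \<comment> \<open>\<open>V\<close> enters with the factor \<open>p^6\<close>, so precision
    \<open>p^3\<close> suffices and the \<open>p^4\<close> term of the expansion drops out.\<close>
  have d2: "V - (h 3 - 2 * ?P ^ 2 * W) \<in> I 3"
  proof -
    have "(a (j - 1) - (1 - 2 * ?P ^ 2 * power_harmonic 2 (j - 1))) * (1 / of_nat j ^ 3) \<in> I 3"
      if j: "j \<in> {1..p-1}" for j
    proof -
      let ?s = "power_harmonic 2 (j - 1)" and ?t = "power_harmonic 4 (j - 1)"
      have "a (j - 1) - (1 - 2 * ?P ^ 2 * ?s + ?P ^ 4 * (2 * ?s ^ 2 - ?t)) \<in> I 3"
        unfolding a_def using p7 j by (intro I_antimono[OF square_product_expansion]) auto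
      moreover have "?P ^ 4 * (2 * ?s ^ 2 - ?t) \<in> I 3"
        using j by (intro p_multiple_I Z_diff Z_mult Z_power power_harmonic_Z) auto
      ultimately have "a (j - 1) - (1 - 2 * ?P ^ 2 * ?s + ?P ^ 4 * (2 * ?s ^ 2 - ?t))
          + ?P ^ 4 * (2 * ?s ^ 2 - ?t) \<in> I 3"
        by (rule I_add)
      also have "a (j - 1) - (1 - 2 * ?P ^ 2 * ?s + ?P ^ 4 * (2 * ?s ^ 2 - ?t))
          + ?P ^ 4 * (2 * ?s ^ 2 - ?t) = a (j - 1) - (1 - 2 * ?P ^ 2 * ?s)"
        by simp
      finally have "a (j - 1) - (1 - 2 * ?P ^ 2 * ?s) \<in> I 3" .
      then show ?thesis using j by (intro I_mult_Z Z_inverse_power not_dvd_residue)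
    qed
    then have "(\<Sum>j=1..p-1. (a (j - 1) - (1 - 2 * ?P ^ 2 * power_harmonic 2 (j - 1))) * (1 / of_nat j ^ 3)) \<in> I 3"
      by (rule I_sum)
    also have "(\<Sum>j=1..p-1. (a (j - 1) - (1 - 2 * ?P ^ 2 * power_harmonic 2 (j - 1))) * (1 / of_nat j ^ 3))
        = V - (h 3 - 2 * ?P ^ 2 * W)"
      unfolding V_def W_def h_def power_harmonic_def[of 3] sum_distrib_left sum_subtractf[symmetric]
      by (intro sum.cong) (auto simp: field_simps)
    finally show ?thesis .
  qed
  note d3 = reflection_harmonic[folded h_def]
  note d4 = reflection_harmonic_3[folded h_def]
  have d5: "h 4 - 4 / 5 * (?P * B) \<in> I 2"
    unfolding h_def B_def using p7 by (rule power_harmonic_4_bernoulli)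
  have d6: "W + 2 * B \<in> I 1"
    unfolding W_def B_def using p7 by (rule double_sum_bernoulli)
  have half: "1 / of_nat 2 \<in> Z" using p7 by (intro Z_inverse_of_nat) (auto dest: dvd_imp_le)
  \<comment> \<open>After \<open>d1\<close> and \<open>d2\<close>, subtracting \<open>2*p^4\<close>
    times \<open>d3\<close> eliminates \<open>h 2\<close>, leaving \<open>3*p^6 * h 3\<close>;
    adding \<open>3/2 * p^6\<close> times \<open>d4\<close> removes that and leaves
    \<open>-7/2 * p^7 * h 4 - 7*p^8 * h 5 - 2*p^8 * W\<close>. With \<open>d5\<close>,
    \<open>h5\<close> and \<open>d6\<close> the coefficient of \<open>p^8 * B\<close> is
    \<open>-14/5 + 4 = 6/5\<close>.\<close>
  have "?P ^ 3 * (a (p - 1) - (1 - 2 * ?P ^ 2 * h 2 - ?P ^ 4 * h 4)) + ?P ^ 6 * (V - (h 3 - 2 * ?P ^ 2 * W))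
      - ?P ^ 4 * (2 * (2 * h 1 + ?P * h 2 + ?P ^ 2 * h 3 + ?P ^ 3 * h 4 + ?P ^ 4 * h 5))
      + ?P ^ 6 * (3 * (1 / of_nat 2) * (2 * h 3 + 3 * ?P * h 4 + 6 * ?P ^ 2 * h 5))
      - ?P ^ 7 * (7 * (1 / of_nat 2) * (h 4 - 4 / 5 * (?P * B)))
      - ?P ^ 8 * (7 * h 5) - ?P ^ 8 * (2 * (W + 2 * B)) \<in> I 9"
  proof (intro I_add I_diff)
    show "?P ^ 3 * (a (p - 1) - (1 - 2 * ?P ^ 2 * h 2 - ?P ^ 4 * h 4)) \<in> I 9"
      by (rule I_p_power_mult[OF d1]) simp
    show "?P ^ 6 * (V - (h 3 - 2 * ?P ^ 2 * W)) \<in> I 9"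
      by (rule I_p_power_mult[OF d2]) simp
    show "?P ^ 4 * (2 * (2 * h 1 + ?P * h 2 + ?P ^ 2 * h 3 + ?P ^ 3 * h 4 + ?P ^ 4 * h 5)) \<in> I 9"
      by (rule I_p_power_mult[OF I_Z_mult[OF Z_numeral d3]]) simp
    show "?P ^ 6 * (3 * (1 / of_nat 2) * (2 * h 3 + 3 * ?P * h 4 + 6 * ?P ^ 2 * h 5)) \<in> I 9"
      by (rule I_p_power_mult[OF I_Z_mult[OF Z_mult[OF Z_numeral half] d4]]) simp
    show "?P ^ 7 * (7 * (1 / of_nat 2) * (h 4 - 4 / 5 * (?P * B))) \<in> I 9"
      by (rule I_p_power_mult[OF I_Z_mult[OF Z_mult[OF Z_numeral half] d5]]) simp
    show "?P ^ 8 * (7 * h 5) \<in> I 9"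
      by (rule I_p_power_mult[OF I_Z_mult[OF Z_numeral h5]]) simp
    show "?P ^ 8 * (2 * (W + 2 * B)) \<in> I 9"
      by (rule I_p_power_mult[OF I_Z_mult[OF Z_numeral d6]]) simp
  qed
  also have "?P ^ 3 * (a (p - 1) - (1 - 2 * ?P ^ 2 * h 2 - ?P ^ 4 * h 4)) + ?P ^ 6 * (V - (h 3 - 2 * ?P ^ 2 * W))
      - ?P ^ 4 * (2 * (2 * h 1 + ?P * h 2 + ?P ^ 2 * h 3 + ?P ^ 3 * h 4 + ?P ^ 4 * h 5))
      + ?P ^ 6 * (3 * (1 / of_nat 2) * (2 * h 3 + 3 * ?P * h 4 + 6 * ?P ^ 2 * h 5))
      - ?P ^ 7 * (7 * (1 / of_nat 2) * (h 4 - 4 / 5 * (?P * B)))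
      - ?P ^ 8 * (7 * h 5) - ?P ^ 8 * (2 * (W + 2 * B))
    = ?P ^ 2 * (?P * a (p - 1) + ?P ^ 4 * V) - (?P ^ 3 + 4 * ?P ^ 4 * h 1 + 6 / 5 * ?P ^ 8 * B)"
    by (simp add: field_simps) (simp add: algebra_simps eval_nat_numeral)
  finally have main: "?P ^ 2 * (?P * a (p - 1) + ?P ^ 4 * V) - (?P ^ 3 + 4 * ?P ^ 4 * h 1 + 6 / 5 * ?P ^ 8 * B) \<in> I 9" .
  have "6 / of_nat 5 \<in> Z" using p7 by (intro Z_divide_of_nat) (auto dest: dvd_imp_le)
  moreover have "h 1 \<in> Z" "B \<in> Z"
    using p7 by (auto simp: h_def B_def intro: power_harmonic_Z bernoulli_Z)
  ultimately have "?P ^ 3 + 4 * ?P ^ 4 * h 1 + 6 / 5 * ?P ^ 8 * B \<in> Z"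
    by (intro Z_add Z_mult Z_power) auto
  from cong_pow_I[OF main this] show ?thesis
    unfolding S h1 B_def .
qed

lemma cong_pow_apery_5:
  "cong_pow 5 9
     (\<Sum>k=0..5-1. of_nat ((2 * k + 1)^3 * apery k))
     (of_nat 5 ^ 3 + 4 * of_nat 5 ^ 4 * harmonic (5 - 1) + 6 / 5 * of_nat 5 ^ 8 * bernoulli (5 - 5))"
proof -
  interpret prime_localization 5 by unfold_locales simp
  have choose: "(3 choose 2) = (3 :: nat)" "(4 choose 2) = (6 :: nat)" "(4 choose 3) = (4 :: nat)"
    "(5 choose 2) = (10 :: nat)" "(6 choose 2) = (15 :: nat)" "(6 choose 3) = (20 :: nat)"
    "(7 choose 3) = (35 :: nat)" "(8 choose 4) = (70 :: nat)"
    by (simp_all add: numeral_eq_Suc)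
  have ivl: "{0..1::nat} = {0, 1}" "{0..2::nat} = {0, 1, 2}" "{0..3::nat} = {0, 1, 2, 3}"
    "{0..4::nat} = {0, 1, 2, 3, 4}" "{1..4::nat} = {1, 2, 3, 4}"
    by auto
  have "apery 0 = 1" "apery 1 = 5" "apery 2 = 73" "apery 3 = 1445" "apery 4 = 33001"
    unfolding apery_def ivl by (simp_all add: choose power2_eq_square)
  then have S: "(\<Sum>k=0..5-1. of_nat ((2 * k + 1)^3 * apery k)) = (24562625 :: rat)"
    by (simp add: ivl)
  have H: "harmonic (5 - 1) = 25 / 12"
    unfolding harmonic_def using ivl(5) by simp
  \<comment> \<open>With \<open>bernoulli 0 = 1\<close> the two sides differ by exactly
    \<open>5^9 * 37/3\<close>, and the right-hand side is \<open>1422250/3\<close>.\<close>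
  have "of_nat 5 ^ 9 * (of_int 37 / of_nat 3) \<in> I 9"
    by (intro p_multiple_I Z_divide_of_nat) auto
  then have "24562625 - (of_nat 5 ^ 3 + 4 * of_nat 5 ^ 4 * (25 / 12) + 6 / 5 * of_nat 5 ^ 8 * bernoulli (5 - 5)) \<in> I 9"
    by (simp add: bernoulli_0)
  moreover have "of_int 1422250 / of_nat 3 \<in> Z"
    by (intro Z_divide_of_nat) auto
  then have "of_nat 5 ^ 3 + 4 * of_nat 5 ^ 4 * (25 / 12) + 6 / 5 * of_nat 5 ^ 8 * bernoulli (5 - 5) \<in> Z"
    by (simp add: bernoulli_0)
  ultimately show ?thesis unfolding S H by (rule cong_pow_I)
qed

theorem theorem1p2:
  fixes p :: nat
  assumes "prime p" and "p \<ge> 5"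
  shows "cong_pow p 9
           (\<Sum>k=0..p-1. of_nat ((2 * k + 1)^3 * apery k))
           (of_nat p ^ 3 + 4 * of_nat p ^ 4 * harmonic (p - 1)
              + 6 / 5 * of_nat p ^ 8 * bernoulli (p - 5))"
proof (cases "p = 5")
  case True
  then show ?thesis using cong_pow_apery_5 by (simp only:)
next
  case False
  have "p \<noteq> 6"
  proof
    assume "p = 6"
    then have "p = 2 * 3" by simp
    with assms(1) show False using prime_product[of 2 3] by auto
  qed
  with False assms show ?thesis by (intro cong_pow_apery_ge_7) auto
qed

end
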